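(* Let $n>1$ and $1\le k\le n$ be integers, and let $G(n,k)$ be the digraph of the endomorphism $x\mapsto x^k$ of a cyclic group of order $n$. Suppose the components of $G(n,k)$ consist of $m_1$ copies of $G_1$, $m_2$ copies of $G_2$, $\ldots$, $m_s$ copies of $G_s$, where $G_1,\ldots,G_s$ are pairwise non-isomorphic digraphs, and for each $1\le i\le s$ the unique cycle in $G_i$ has length $r_i$. Then: (1) The characteristic polynomial of (the adjacency matrix of) $G(n,k)$ is $\prod_{i=1}^{s}\big[\lambda^{r_i w-r_i}(\lambda^{r_i}-1)\big]^{m_i}$. (2) The minimal polynomial of (the adjacency matrix of) $G(n,k)$ is $\lambda^{h_0}(\lambda^{\ell(t)}-1)$.
   Context: Let $H$ be a cyclic group (written multiplicatively, identity $1$) with $n>1$ elements, let $1\le k\le n$, and let $f:H\to H$, $f(x)=x^k$. $G(n,k)$ is the digraph with vertex set $H$ and a directed edge from $a$ to $b$ if and only if $f(a)=b$ (loops allowed); up to isomorphism it depends only on $n$ and $k$. Components are the (weakly) connected components; each contains exactly one directed cycle (a loop is a cycle of length $1$). Vertices lying on directed cycles are called cycle vertices. Write $n=tw$, where $t$ is the largest factor of $n$ relatively prime to $k$. All vertices on one cycle have the same order in $H$, called the order of the cycle; cycles of order $d$ exist exactly for $d\mid t$, and $\ell(d)$ denotes the length of a cycle of order $d$ (so $\ell(t)$ is the multiplicative order of $k$ modulo $t$). The height of a vertex $a$ is the smallest integer $h\ge 0$ such that $a^{k^h}$ is a cycle vertex, and $h_0$ is the largest height of a vertex of $G(n,k)$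 (every tree attached to a cycle vertex has this same height $h_0$). The adjacency matrix of a digraph with vertices $v_1,\ldots,v_n$ is the $n\times n$ $(0,1)$-matrix whose $(i,j)$-entry is the number of directed edges from $v_i$ to $v_j$. *)

theory Defs
  imports
    "HOL-Algebra.Elementary_Groups"
    "HOL-Algebra.Multiplicative_Group"
    "Graph_Theory.Digraph_Isomorphism"
    "Jordan_Normal_Form.Char_Poly"
begin

section \<open>Digraphs\<close>

text \<open>The (weakly) connected components, as subdigraphs. The library's \<^const>\<open>connected\<close> is
  connectedness of the underlying undirected graph.\<close>

definition weak_components :: "('v, 'e) pre_digraph \<Rightarrow> ('v, 'e) pre_digraph set" where
  "weak_components G = {C. pre_digraph.max_subgraph G Digraph_Component.connected C}"

text \<open>Up to isomorphism the components of \<open>G\<close> are \<open>m i\<close> copies of \<open>Gs i\<close>, for \<open>1 \<le> i \<le> s\<close>. The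
  model digraphs \<open>Gs i\<close> need not be subdigraphs of \<open>G\<close>, nor have the same vertex type.\<close>

definition components_consist_of ::
  "('v, 'e) pre_digraph \<Rightarrow> nat \<Rightarrow> (nat \<Rightarrow> nat) \<Rightarrow> (nat \<Rightarrow> ('u, 'd) pre_digraph) \<Rightarrow> bool" where
  "components_consist_of G s m Gs \<longleftrightarrow>
     (\<forall>i\<in>{1..s}. m i \<ge> 1) \<and>
     (\<forall>i\<in>{1..s}. \<forall>j\<in>{1..s}. i \<noteq> j \<longrightarrow> \<not> digraph_iso (Gs i) (Gs j)) \<and>
     (\<forall>C\<in>weak_components G. \<exists>i\<in>{1..s}. digraph_iso C (Gs i)) \<and>
     (\<forall>i\<in>{1..s}. card {C \<in> weak_components G. digraph_iso C (Gs i)} = m i)"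

text \<open>A cycle is represented by its list of arcs, from an arbitrary starting point; a loop is a
  cycle of length 1.\<close>

definition cycle_vertex :: "('v, 'e) pre_digraph \<Rightarrow> 'v \<Rightarrow> bool" where
  "cycle_vertex G v \<longleftrightarrow> (\<exists>p. pre_digraph.cycle G p \<and> v \<in> tail G ` set p)"

definition adjacency_matrix :: "('v, 'e) pre_digraph \<Rightarrow> 'v list \<Rightarrow> 'f::semiring_1 mat" where
  "adjacency_matrix G vs = Matrix.mat (length vs) (length vs)
     (\<lambda>(i, j). of_nat (card {e \<in> arcs G. tail G e = vs ! i \<and> head G e = vs ! j}))"

section \<open>The digraph of the map \<open>x \<mapsto> x\<^sup>k\<close>\<close>

definition power_digraph :: "('a, 'b) monoid_scheme \<Rightarrow> nat \<Rightarrow> ('a, 'a \<times> 'a) pre_digraph" where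
  "power_digraph H k = with_proj
     \<lparr>pverts = carrier H, parcs = {(a, b). a \<in> carrier H \<and> b \<in> carrier H \<and> a [^]\<^bsub>H\<^esub> k = b}\<rparr>"

definition coprime_part :: "nat \<Rightarrow> nat \<Rightarrow> nat" where
  "coprime_part n k = Max {d. d dvd n \<and> coprime d k}"

text \<open>\<open>\<ell>(d)\<close>: the common length of the cycles all of whose vertices have order \<open>d\<close> in \<open>H\<close>.\<close>

definition cycle_length :: "('a, 'b) monoid_scheme \<Rightarrow> nat \<Rightarrow> nat \<Rightarrow> nat" where
  "cycle_length H k d = (THE l. \<exists>p. pre_digraph.cycle (power_digraph H k) p \<and>
     (\<forall>e\<in>set p. group.ord H (tail (power_digraph H k) e) = d) \<and> length p = l)"

definition height :: "('a, 'b) monoid_scheme \<Rightarrow> nat \<Rightarrow> 'a \<Rightarrow> nat" where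
  "height H k a = (LEAST h. cycle_vertex (power_digraph H k) (a [^]\<^bsub>H\<^esub> (k ^ h)))"

definition max_height :: "('a, 'b) monoid_scheme \<Rightarrow> nat \<Rightarrow> nat" where
  "max_height H k = Max (height H k ` carrier H)"

section \<open>Minimal polynomials of matrices\<close>

definition poly_at_mat :: "'f::comm_ring_1 poly \<Rightarrow> 'f mat \<Rightarrow> 'f mat" where
  "poly_at_mat p A =
     (\<Oplus>\<^bsub>ring_mat TYPE('f) (dim_row A) ()\<^esub> i\<in>{..Polynomial.degree p}. Polynomial.coeff p i \<cdot>\<^sub>m (A ^\<^sub>m i))"

definition is_min_poly :: "'f::field mat \<Rightarrow> 'f poly \<Rightarrow> bool" where
  "is_min_poly A p \<longleftrightarrow>
     monic p \<and> poly_at_mat p A = 0\<^sub>m (dim_row A) (dim_row A) \<and>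
     (\<forall>q. monic q \<and> poly_at_mat q A = 0\<^sub>m (dim_row A) (dim_row A) \<longrightarrow>
        Polynomial.degree p \<le> Polynomial.degree q)"

end

theory Submission
  imports Defs
begin

text \<open>
  Let \<open>f\<close> be a self-map of a finite set and \<open>A\<close> the adjacency matrix of its digraph, so that
  row \<open>v\<close> of \<open>A\<close> has its only nonzero entry, a \<open>1\<close>, in column \<open>f v\<close>. Both halves of the theorem
  come from facts about such matrices, combined with the arithmetic of \<open>x \<mapsto> x\<^sup>k\<close>.

  Characteristic polynomial. Reordering the vertices conjugates \<open>A\<close>, and a set of vertices closed
  under \<open>f\<close> splits off a triangular block. Hence the characteristic polynomial is the product over
  the components, and inside a component every vertex off the cycle contributes a factor
  \<open>\<lambda>\<close> (remove the vertices without preimage one by one), while a cycle of length \<open>r\<close> contributes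
  \<open>\<lambda>\<^sup>r - 1\<close> (Laplace expansion). For the power map, the iterate with exponent \<open>h\<^sub>0\<close> is an
  endomorphism whose image is the set of cycle vertices, a subgroup of order \<open>t\<close>; so its fibres all
  have \<open>n / t = w\<close> elements, and a component whose cycle has length \<open>r\<close>, being the preimage of that
  cycle, has \<open>r w\<close> vertices. The lemmas \<open>char_poly_on_periodic_part\<close>, \<open>char_poly_on_components\<close>,
  \<open>card_fibre\<close> and \<open>card_component\<close> carry this part; \<open>weak_components_map_digraph\<close> connects the
  orbits of the map with the graph-theoretic components.

  Minimal polynomial. Let \<open>g\<close> generate the group. Every element is a power of \<open>g\<close>, and the iterates
  of the map commute with taking powers, so \<open>g\<close> has the largest height \<open>h\<^sub>0\<close>, and the first cycle
  vertex \<open>y\<close> on its way has a period that is a period of every cycle. The order of \<open>y\<close> is \<open>t\<close>: it is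
  coprime to \<open>k\<close> because \<open>y\<close> is fixed by some \<open>x \<mapsto> x\<^bsup>k^m\<^esup>\<close> with \<open>m > 0\<close>, and it is a multiple of
  every divisor of \<open>n\<close> coprime to \<open>k\<close> because \<open>n\<close> divides a power of \<open>k\<close> times the order of \<open>y\<close>. Whether an
  iterate fixes an element depends only on the order of the element, so the period of \<open>y\<close> is
  \<open>\<ell>(t)\<close>. Consequently iterates \<open>h\<^sub>0 + \<ell>(t)\<close> and \<open>h\<^sub>0\<close> agree everywhere, which gives an annihilating
  polynomial, while the first \<open>h\<^sub>0 + \<ell>(t)\<close> iterates of \<open>g\<close> are distinct, so the row of \<open>g\<close> in \<open>q(A)\<close>
  displays the coefficients of any \<open>q\<close> of smaller degree and forbids \<open>q(A) = 0\<close>.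
\<close>

section \<open>The matrix of a self-map along a list\<close>

definition transition_mat :: "('v \<Rightarrow> 'v) \<Rightarrow> 'v list \<Rightarrow> 'f::semiring_1 mat" where
  "transition_mat f vs = Matrix.mat (length vs) (length vs)
     (\<lambda>(i, j). if f (vs ! i) = vs ! j then 1 else 0)"

lemma transition_mat_carrier [simp]:
  "transition_mat f vs \<in> carrier_mat (length vs) (length vs)"
  by (simp add: transition_mat_def)

lemma dim_transition_mat [simp]:
  "dim_row (transition_mat f vs) = length vs" "dim_col (transition_mat f vs) = length vs"
  by (simp_all add: transition_mat_def)

lemma sum_indicator_nth:
  fixes F :: "'v \<Rightarrow> 'f::semiring_1"
  assumes "distinct vs"
  shows "(\<Sum>k = 0..<length vs. (if x = vs ! k then 1 else 0) * F (vs ! k))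
           = (if x \<in> set vs then F x else 0)"
proof -
  have "bij_betw ((!) vs) {0..<length vs} (set vs)"
    using bij_betw_nth[OF assms] by (simp add: atLeast0LessThan)
  then have "(\<Sum>k = 0..<length vs. (if x = vs ! k then 1 else 0) * F (vs ! k))
      = (\<Sum>y\<in>set vs. (if x = y then 1 else 0) * F y)"
    by (rule sum.reindex_bij_betw)
  also have "\<dots> = (\<Sum>y\<in>set vs. if x = y then F y else 0)"
    by (rule sum.cong) auto
  finally show ?thesis by (simp add: sum.delta)
qed

text \<open>Reordering the list conjugates the matrix by a permutation matrix.\<close>

lemma char_poly_transition_mat_reorder:
  fixes f :: "'v \<Rightarrow> 'v"
  assumes us: "distinct us" and vs: "distinct vs" and eq: "set us = set vs"
  shows "char_poly (transition_mat f us) = (char_poly (transition_mat f vs) :: 'f::comm_ring_1 poly)"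
proof -
  define n where "n = length vs"
  have lus: "length us = n"
    using us vs eq by (metis distinct_card n_def)
  define P where "P = (\<lambda>(xs :: 'v list) ys. Matrix.mat n n (\<lambda>(i, j). if xs ! i = ys ! j then 1 else 0) :: 'f mat)"
  define B where "B = (transition_mat f vs :: 'f mat)"
  have P_inv: "P xs ys * P ys xs = 1\<^sub>m n"
    if "distinct xs" "distinct ys" "set xs = set ys" "length xs = n" "length ys = n"
    for xs ys :: "'v list"
  proof (rule eq_matI)
    fix i j assume "i < dim_row (1\<^sub>m n)" "j < dim_col (1\<^sub>m n)"
    then have ij: "i < n" "j < n" by auto
    have "(P xs ys * P ys xs) $$ (i, j)
        = (\<Sum>k = 0..<length ys. (if xs ! i = ys ! k then 1 else 0) * (if ys ! k = xs ! j then 1 else 0))"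
      using ij that by (simp add: P_def scalar_prod_def)
    also have "\<dots> = (if xs ! i = xs ! j then 1 else 0)"
      by (subst sum_indicator_nth[OF that(2), where F = "\<lambda>y. if y = xs ! j then 1 else 0"])
        (use ij that nth_mem[of i xs] in auto)
    finally show "(P xs ys * P ys xs) $$ (i, j) = 1\<^sub>m n $$ (i, j)"
      using ij that by (simp add: nth_eq_iff_index_eq)
  qed (auto simp: P_def)
  have "transition_mat f us = P us vs * B * P vs us"
  proof (rule eq_matI)
    fix i j assume "i < dim_row (P us vs * B * P vs us)" "j < dim_col (P us vs * B * P vs us)"
    then have ij: "i < n" "j < n" by (auto simp: P_def)
    have PB: "(P us vs * B) $$ (i, j') = (if f (us ! i) = vs ! j' then 1 else 0)" if "j' < n" for j'
    proof -
      have "(P us vs * B) $$ (i, j')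
        = (\<Sum>k = 0..<length vs. (if us ! i = vs ! k then 1 else 0) * (if f (vs ! k) = vs ! j' then 1 else 0))"
        using ij that by (simp add: P_def B_def transition_mat_def n_def scalar_prod_def)
      also have "\<dots> = (if f (us ! i) = vs ! j' then 1 else 0)"
        by (subst sum_indicator_nth[OF vs, where F = "\<lambda>y. if f y = vs ! j' then 1 else 0"])
          (use ij lus eq nth_mem[of i us] in auto)
      finally show ?thesis .
    qed
    have "(P us vs * B * P vs us) $$ (i, j) = (\<Sum>k = 0..<n. (P us vs * B) $$ (i, k) * P vs us $$ (k, j))"
    proof -
      define M where "M = P us vs * B"
      have "M \<in> carrier_mat n n" "P vs us \<in> carrier_mat n n"
        by (auto simp: M_def P_def B_def n_def)
      then show ?thesis
        unfolding M_def[symmetric] using ij by (simp add: scalar_prod_def)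
    qed
    also have "\<dots> = (\<Sum>k = 0..<length vs. (if f (us ! i) = vs ! k then 1 else 0) * (if vs ! k = us ! j then 1 else 0))"
      by (rule sum.cong) (use ij PB in \<open>auto simp: n_def P_def\<close>)
    also have "\<dots> = (if f (us ! i) = us ! j then 1 else 0)"
      by (subst sum_indicator_nth[OF vs, where F = "\<lambda>y. if y = us ! j then 1 else 0"])
        (use ij lus eq nth_mem[of j us] in auto)
    finally show "transition_mat f us $$ (i, j) = (P us vs * B * P vs us) $$ (i, j)"
      using ij lus by (simp add: transition_mat_def)
  qed (auto simp: P_def lus)
  moreover have "{transition_mat f us, B, P us vs, P vs us} \<subseteq> carrier_mat n n"
    using lus by (auto simp: P_def B_def n_def transition_mat_def)
  ultimately have "similar_mat (transition_mat f us) B"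
    using P_inv[OF us vs eq lus] P_inv[OF vs us] eq lus n_def by (intro similar_matI) auto
  then show ?thesis
    unfolding B_def by (rule char_poly_similar)
qed

text \<open>If no vertex of the first list is mapped into the second, the matrix is block lower
  triangular.\<close>

lemma char_poly_transition_mat_append:
  fixes f :: "'v \<Rightarrow> 'v"
  assumes "f ` set us \<inter> set ws = {}"
  shows "char_poly (transition_mat f (us @ ws))
           = char_poly (transition_mat f us) * (char_poly (transition_mat f ws) :: 'f::idom poly)"
proof -
  define m n where "m = length us" and "n = length ws"
  define X where "X = (char_poly_matrix (transition_mat f (us @ ws)) :: 'f poly mat)"
  define C where "C = Matrix.mat n m (\<lambda>(i, j). X $$ (m + i, j))"
  have no_edge: "f (us ! i) \<noteq> ws ! j" if "i < m" "j < n" for i j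
    using that assms m_def n_def by (metis disjoint_iff imageI nth_mem)
  have "X = four_block_mat (char_poly_matrix (transition_mat f us)) (0\<^sub>m m n)
          C (char_poly_matrix (transition_mat f ws))"
    by (rule eq_matI)
      (auto simp: X_def C_def char_poly_matrix_def transition_mat_def m_def[symmetric]
        n_def[symmetric] nth_append no_edge not_less algebra_simps)
  then have "det X = det (char_poly_matrix (transition_mat f us)) * det (char_poly_matrix (transition_mat f ws))"
    by (simp only:)
      (rule det_four_block_mat_upper_right_zero[where n = m and m = n];
        simp add: m_def n_def C_def)
  then show ?thesis
    by (simp add: char_poly_def X_def)
qed

lemma char_poly_transition_mat_singleton:
  fixes f :: "'v \<Rightarrow> 'v"
  shows "char_poly (transition_mat f [v])
           = (if f v = v then Polynomial.monom 1 1 - 1 else Polynomial.monom 1 1 :: 'f::idom poly)"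
  by (subst char_poly_upper_triangular[where n = 1])
    (auto simp: transition_mat_def upper_triangular_def diag_mat_def monom_altdef one_pCons)

text \<open>Along a cycle, Laplace expansion by the first column leaves two triangular minors: one with
  the indeterminate on the diagonal, one with \<open>-1\<close>.\<close>

lemma char_poly_transition_mat_cycle:
  fixes f :: "'v \<Rightarrow> 'v"
  assumes dist: "distinct us" and "us \<noteq> []"
    and step: "\<And>i. i < length us \<Longrightarrow> f (us ! i) = us ! (Suc i mod length us)"
  shows "char_poly (transition_mat f us) = (Polynomial.monom 1 (length us) - 1 :: 'f::idom poly)"
proof (cases "length us = 1")
  case True
  then obtain v where "us = [v]" by (metis One_nat_def length_0_conv length_Suc_conv)
  then show ?thesis
    using step[of 0] by (simp add: char_poly_transition_mat_singleton)
next
  case False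
  with \<open>us \<noteq> []\<close> obtain q where q: "length us = Suc q" "q > 0"
    by (cases "length us") auto
  define X where "X = (char_poly_matrix (transition_mat f us) :: 'f poly mat)"
  have Xc: "X \<in> carrier_mat (Suc q) (Suc q)"
    by (simp add: X_def q flip: q(1))
  have X: "X $$ (i, j) = (if i = j then [:0, 1:] else 0) + (if (if i = q then 0 else Suc i) = j then -1 else 0)"
    if "i < Suc q" "j < Suc q" for i j
    using that step[of i] dist q
    by (auto simp: X_def char_poly_matrix_def transition_mat_def nth_eq_iff_index_eq one_pCons)
  have upper: "det (mat_delete X 0 0) = [:0, 1:] ^ q"
  proof (subst det_upper_triangular[where n = q])
    show "upper_triangular (mat_delete X 0 0)"
      using Xc by (auto simp: upper_triangular_def mat_delete_def X)
    show "mat_delete X 0 0 \<in> carrier_mat q q"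
      using mat_delete_carrier[OF Xc] by simp
    have "diag_mat (mat_delete X 0 0) = map (\<lambda>i. [:0, 1:]) [0..<q]"
      using Xc q(2) by (auto simp: diag_mat_def mat_delete_def X)
    then show "prod_list (diag_mat (mat_delete X 0 0)) = [:0, 1:] ^ q"
      by (simp add: map_replicate_const)
  qed
  have lower: "det (mat_delete X q 0) = (-1) ^ q"
  proof (subst det_lower_triangular[where n = q])
    show "mat_delete X q 0 $$ (i, j) = 0" if "i < j" "j < q" for i j
      using Xc that by (auto simp: mat_delete_def X)
    show "mat_delete X q 0 \<in> carrier_mat q q"
      using mat_delete_carrier[OF Xc] by simp
    have "diag_mat (mat_delete X q 0) = map (\<lambda>i. -1) [0..<q]"
      using Xc by (auto simp: diag_mat_def mat_delete_def X)
    then show "prod_list (diag_mat (mat_delete X q 0)) = (-1) ^ q"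
      by (simp add: map_replicate_const)
  qed
  have "det X = (\<Sum>i<Suc q. X $$ (i, 0) * cofactor X i 0)"
    by (rule laplace_expansion_column[OF Xc]) simp
  also have "\<dots> = (\<Sum>i\<in>{0, q}. X $$ (i, 0) * cofactor X i 0)"
    by (rule sum.mono_neutral_right) (auto simp: X)
  also have "\<dots> = [:0, 1:] * [:0, 1:] ^ q + (-1) * ((-1) ^ q * (-1) ^ q)"
    using q(2) by (simp add: cofactor_def upper lower X)
  also have "\<dots> = Polynomial.monom 1 (Suc q) - 1"
    by (simp add: monom_altdef flip: power_mult_distrib)
  finally show ?thesis
    by (simp add: char_poly_def X_def q)
qed

text \<open>The choice of the list is immaterial by the invariance under reordering; passing to sets
  allows products over disjoint unions without keeping track of concatenated lists.\<close>

definition char_poly_on :: "('v \<Rightarrow> 'v) \<Rightarrow> 'v set \<Rightarrow> 'f::comm_ring_1 poly" where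
  "char_poly_on f S = char_poly (transition_mat f (SOME vs. distinct vs \<and> set vs = S))"

lemma char_poly_on_eq:
  assumes "distinct vs" "set vs = S"
  shows "char_poly_on f S = char_poly (transition_mat f vs)"
proof -
  have "\<exists>vs. distinct vs \<and> set vs = S" using assms by blast
  then have "distinct (SOME vs. distinct vs \<and> set vs = S) \<and> set (SOME vs. distinct vs \<and> set vs = S) = S"
    by (rule someI_ex)
  then show ?thesis
    unfolding char_poly_on_def using assms by (intro char_poly_transition_mat_reorder) auto
qed

lemma char_poly_on_empty [simp]: "char_poly_on f {} = (1 :: 'f::idom poly)"
  by (subst char_poly_on_eq[of "[]"])
    (simp_all add: char_poly_def char_poly_matrix_def transition_mat_def det_dim_zero[of _])

lemma char_poly_on_Un:
  assumes "finite S" "finite T" "S \<inter> T = {}" "f ` S \<inter> T = {}"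
  shows "char_poly_on f (S \<union> T) = char_poly_on f S * (char_poly_on f T :: 'f::idom poly)"
proof -
  obtain us ws where us: "distinct us" "set us = S" and ws: "distinct ws" "set ws = T"
    using assms finite_distinct_list by metis
  show ?thesis
    using assms us ws
    by (simp add: char_poly_on_eq[OF us] char_poly_on_eq[OF ws]
        char_poly_on_eq[of "us @ ws" "S \<union> T"] char_poly_transition_mat_append)
qed

text \<open>Closed sets send no arcs to one another, so the factors split off one at a time.\<close>

lemma char_poly_on_Union:
  assumes "finite CC" "\<And>C. C \<in> CC \<Longrightarrow> finite C \<and> f ` C \<subseteq> C" "disjoint CC"
  shows "char_poly_on f (\<Union>CC) = (\<Prod>C\<in>CC. char_poly_on f C :: 'f::idom poly)"
  using assms
proof (induction rule: finite_induct)
  case (insert C CC)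
  have disj: "C \<inter> \<Union>CC = {}"
    using insert.prems(2) insert.hyps(2) by (fastforce simp: disjoint_def)
  have "char_poly_on f (\<Union>(insert C CC)) = (char_poly_on f (C \<union> \<Union>CC) :: 'f poly)" by simp
  also have "\<dots> = char_poly_on f C * char_poly_on f (\<Union>CC)"
  proof (rule char_poly_on_Un)
    show "finite C" "finite (\<Union>CC)" using insert.prems(1) insert.hyps(1) by auto
    show "C \<inter> \<Union>CC = {}" by (rule disj)
    show "f ` C \<inter> \<Union>CC = {}" using insert.prems(1)[of C] disj by auto
  qed
  finally show ?case
    using insert by (simp add: disjoint_def)
qed simp

section \<open>Self-maps of a finite set\<close>

locale finite_self_map =
  fixes V :: "'v set" and f :: "'v \<Rightarrow> 'v"
  assumes finite_V: "finite V" and maps_to: "x \<in> V \<Longrightarrow> f x \<in> V"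
begin

definition periodic :: "'v \<Rightarrow> bool" where
  "periodic x \<longleftrightarrow> x \<in> V \<and> (\<exists>m>0. (f ^^ m) x = x)"

definition period :: "'v \<Rightarrow> nat" where
  "period x = (LEAST m. m > 0 \<and> (f ^^ m) x = x)"

definition forward_orbit :: "'v \<Rightarrow> 'v set" where
  "forward_orbit x = (\<lambda>i. (f ^^ i) x) ` {..<period x}"

lemma funpow_in_V: "x \<in> V \<Longrightarrow> (f ^^ m) x \<in> V"
  by (induction m) (auto intro: maps_to)

lemma funpow_add_apply: "(f ^^ (a + b)) x = (f ^^ a) ((f ^^ b) x)"
  by (simp add: funpow_add)

lemma funpow_swap_apply: "(f ^^ a) ((f ^^ b) x) = (f ^^ b) ((f ^^ a) x)"
  by (metis add.commute funpow_add_apply)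

lemma periodic_in_V: "periodic x \<Longrightarrow> x \<in> V"
  by (simp add: periodic_def)

lemma periodic_funpow: "periodic x \<Longrightarrow> periodic ((f ^^ i) x)"
  unfolding periodic_def by (metis funpow_in_V funpow_swap_apply)

lemma periodicI_repeat:
  assumes "x \<in> V" "a < b" "(f ^^ a) x = (f ^^ b) x"
  shows "periodic ((f ^^ a) x)"
proof -
  have "(f ^^ (b - a)) ((f ^^ a) x) = (f ^^ a) x"
    using assms(2,3) funpow_add_apply[of "b - a" a x] by simp
  then show ?thesis
    unfolding periodic_def using assms funpow_in_V by (auto intro!: exI[of _ "b - a"])
qed

lemma eventually_periodic:
  assumes "x \<in> V"
  shows "\<exists>h. periodic ((f ^^ h) x)"
proof -
  have "finite (range (\<lambda>i. (f ^^ i) x))"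
    using assms finite_V funpow_in_V by (auto intro: finite_subset)
  then have "\<not> inj (\<lambda>i. (f ^^ i) x)"
    using finite_imageD infinite_UNIV_nat by blast
  then obtain a b where "a < b" "(f ^^ a) x = (f ^^ b) x"
    by (auto simp: inj_def) (metis nat_neq_iff)
  then show ?thesis using assms periodicI_repeat by blast
qed

lemma period_props:
  assumes "periodic x"
  shows "period x > 0" "(f ^^ period x) x = x"
  using assms LeastI_ex[of "\<lambda>m. m > 0 \<and> (f ^^ m) x = x"]
  by (auto simp: periodic_def period_def)

lemma period_le: "m > 0 \<Longrightarrow> (f ^^ m) x = x \<Longrightarrow> period x \<le> m"
  unfolding period_def by (rule Least_le) simp

lemma period_unique:
  assumes "periodic x" "\<And>m. (f ^^ m) x = x \<longleftrightarrow> (f ^^ m) y = y"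
  shows "period y = period x"
  using assms by (simp add: period_def)

lemma funpow_period_mult:
  assumes "periodic x"
  shows "(f ^^ (c * period x)) x = x"
proof (induction c)
  case (Suc c)
  then show ?case
    using period_props[OF assms] by (simp add: funpow_add_apply)
qed simp

lemma funpow_mod_period:
  assumes "periodic x"
  shows "(f ^^ (m mod period x)) x = (f ^^ m) x"
proof -
  have "(f ^^ m) x = (f ^^ (m mod period x + m div period x * period x)) x"
    by (simp only: mod_div_mult_eq)
  then show ?thesis by (simp only: funpow_add_apply funpow_period_mult[OF assms])
qed

text \<open>On a cycle every iterate of the map is inverted by another one, since an iterate by a multiple
  of the period is the identity there.\<close>

lemma funpow_return:
  assumes "periodic x"
  obtains m where "(f ^^ m) ((f ^^ a) x) = x"
proof -
  have "(f ^^ (a * period x - a)) ((f ^^ a) x) = x"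
    using period_props(1)[OF assms] funpow_period_mult[OF assms, of a]
    by (simp flip: funpow_add_apply)
  then show ?thesis by (rule that)
qed

lemma inj_on_funpow_period:
  assumes "periodic x"
  shows "inj_on (\<lambda>i. (f ^^ i) x) {..<period x}"
proof (rule linorder_inj_onI)
  fix a b assume ab: "a < b" "a \<in> {..<period x}" "b \<in> {..<period x}"
  show "(f ^^ a) x \<noteq> (f ^^ b) x"
  proof
    assume eq: "(f ^^ a) x = (f ^^ b) x"
    obtain m where m: "(f ^^ m) ((f ^^ a) x) = x" using funpow_return[OF assms] .
    have "(f ^^ b) x = (f ^^ (b - a)) ((f ^^ a) x)" using ab by (simp flip: funpow_add_apply)
    then have "(f ^^ (b - a)) x = x"
      using m eq by (metis funpow_swap_apply)
    then have "period x \<le> b - a" using ab by (intro period_le) auto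
    then show False using ab by auto
  qed
qed auto

lemma card_forward_orbit: "periodic x \<Longrightarrow> card (forward_orbit x) = period x"
  unfolding forward_orbit_def by (simp add: card_image inj_on_funpow_period)

lemma forward_orbit_eq:
  assumes "periodic x"
  shows "forward_orbit x = range (\<lambda>i. (f ^^ i) x)"
proof
  show "range (\<lambda>i. (f ^^ i) x) \<subseteq> forward_orbit x"
  proof clarify
    fix i
    have "(f ^^ i) x = (f ^^ (i mod period x)) x"
      using funpow_mod_period[OF assms] by simp
    moreover have "i mod period x < period x"
      using period_props(1)[OF assms] by simp
    ultimately show "(f ^^ i) x \<in> forward_orbit x"
      unfolding forward_orbit_def by blast
  qed
qed (auto simp: forward_orbit_def)

lemma char_poly_on_forward_orbit:
  assumes "periodic x"
  shows "char_poly_on f (forward_orbit x) = (Polynomial.monom 1 (period x) - 1 :: 'f::idom poly)"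
proof -
  define us where "us = map (\<lambda>i. (f ^^ i) x) [0..<period x]"
  have len: "length us = period x" by (simp add: us_def)
  have us: "distinct us" "set us = forward_orbit x"
    using inj_on_funpow_period[OF assms]
    by (auto simp: us_def distinct_map forward_orbit_def atLeast0LessThan)
  have "char_poly (transition_mat f us) = (Polynomial.monom 1 (length us) - 1 :: 'f poly)"
  proof (rule char_poly_transition_mat_cycle[OF us(1)])
    show "us \<noteq> []" using len period_props(1)[OF assms] by auto
    fix i assume i: "i < length us"
    have "f (us ! i) = (f ^^ (Suc i mod period x)) x"
      using i len funpow_mod_period[OF assms, of "Suc i"] by (simp add: us_def)
    then show "f (us ! i) = us ! (Suc i mod length us)"
      using period_props(1)[OF assms] by (simp add: us_def)
  qed
  then show ?thesis by (simp add: char_poly_on_eq[OF us] len)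
qed

lemma funpow_closed: "f ` S \<subseteq> S \<Longrightarrow> x \<in> S \<Longrightarrow> (f ^^ m) x \<in> S"
  by (induction m) auto

text \<open>On a closed set covered by its image the map is injective, and an injective iterate
  reflects periodicity.\<close>

lemma surj_on_imp_periodic:
  assumes "S \<subseteq> V" "f ` S \<subseteq> S" "S \<subseteq> f ` S" "x \<in> S"
  shows "periodic x"
proof -
  have "finite S" using assms finite_V finite_subset by blast
  then have inj: "inj_on f S"
    using assms by (metis finite_surj_inj)
  have inS: "(f ^^ m) y \<in> S" if "y \<in> S" for m y
    using assms(2) that by (rule funpow_closed)
  have cancel: "y = z" if "(f ^^ m) y = (f ^^ m) z" "y \<in> S" "z \<in> S" for m y z
    using that
  proof (induction m)
    case (Suc m)
    then show ?case using inj inS by (simp add: inj_on_eq_iff)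
  qed simp
  obtain h where "periodic ((f ^^ h) x)" using eventually_periodic assms by blast
  then obtain m where m: "m > 0" "(f ^^ m) ((f ^^ h) x) = (f ^^ h) x" by (auto simp: periodic_def)
  then have "(f ^^ h) ((f ^^ m) x) = (f ^^ h) x" by (simp add: funpow_swap_apply)
  then have "(f ^^ m) x = x" using cancel inS assms by blast
  then show ?thesis using m assms by (auto simp: periodic_def)
qed

text \<open>A non-periodic vertex outside the image contributes a zero column; deleting such vertices
  one at a time leaves the periodic ones.\<close>

lemma char_poly_on_periodic_part:
  assumes "S \<subseteq> V" "f ` S \<subseteq> S"
  shows "char_poly_on f S = Polynomial.monom 1 (card S - card {x\<in>S. periodic x})
           * (char_poly_on f {x\<in>S. periodic x} :: 'f::idom poly)"
  using assms
proof (induction "card S" arbitrary: S rule: less_induct)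
  case less
  have fin: "finite S" using less.prems finite_V finite_subset by blast
  show ?case
  proof (cases "\<forall>x\<in>S. periodic x")
    case True
    then have "{x\<in>S. periodic x} = S" by blast
    then show ?thesis by simp
  next
    case False
    then have "\<not> S \<subseteq> f ` S"
      using surj_on_imp_periodic[OF less.prems] by metis
    then obtain v where v: "v \<in> S" "v \<notin> f ` S" by auto
    define R where "R = S - {v}"
    have S: "S = R \<union> {v}" "R \<inter> {v} = {}" using v by (auto simp: R_def)
    have np: "\<not> periodic v"
    proof
      assume "periodic v"
      then obtain m where "m > 0" "(f ^^ m) v = v" by (auto simp: periodic_def)
      then have "f ((f ^^ (m - 1)) v) = v" by (cases m) auto
      moreover have "(f ^^ (m - 1)) v \<in> S"
        using v(1) less.prems(2) by (rule funpow_closed[rotated])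
      ultimately show False using v(2) by (metis imageI)
    qed
    have periodic_R: "{x\<in>S. periodic x} = {x\<in>R. periodic x}" using np by (auto simp: R_def)
    have fR: "f ` R \<subseteq> R" using v less.prems(2) by (auto simp: R_def)
    have card_S: "card S = Suc (card R)" unfolding R_def using card_Suc_Diff1[OF fin v(1)] by simp
    have "card {x\<in>R. periodic x} \<le> card R" by (rule card_mono) (use fin in \<open>auto simp: R_def\<close>)
    have "f v \<noteq> v" using v by force
    then have 1: "char_poly_on f {v} = (Polynomial.monom 1 1 :: 'f poly)"
      by (simp add: char_poly_on_eq[of "[v]"] char_poly_transition_mat_singleton)
    have "char_poly_on f S = char_poly_on f R * (char_poly_on f {v} :: 'f poly)"
      unfolding S(1) by (rule char_poly_on_Un) (use fin v fR in \<open>auto simp: R_def\<close>)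
    also have "\<dots> = Polynomial.monom 1 (card R - card {x\<in>R. periodic x})
        * char_poly_on f {x\<in>R. periodic x} * Polynomial.monom 1 1"
    proof -
      have "R \<subseteq> V" using less.prems(1) by (auto simp: R_def)
      then show ?thesis
        unfolding 1 using less.hyps[of R] card_S fR by simp
    qed
    also have "\<dots> = Polynomial.monom 1 (card S - card {x\<in>S. periodic x})
        * char_poly_on f {x\<in>S. periodic x}"
    proof -
      have "Polynomial.monom 1 (card S - card {x\<in>S. periodic x})
          = Polynomial.monom 1 (card R - card {x\<in>R. periodic x}) * (Polynomial.monom 1 1 :: 'f poly)"
        using \<open>card _ \<le> card R\<close> by (simp add: periodic_R card_S Suc_diff_le mult_monom)
      then show ?thesis by (simp only: periodic_R mult.assoc mult.commute mult.left_commute)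
    qed
    finally show ?thesis .
  qed
qed

section \<open>Components of a self-map\<close>

definition component :: "'v \<Rightarrow> 'v set" where
  "component x = {y\<in>V. \<exists>a b. (f ^^ a) x = (f ^^ b) y}"

lemma component_refl: "x \<in> V \<Longrightarrow> x \<in> component x"
  unfolding component_def by blast

lemma component_sym: "x \<in> V \<Longrightarrow> y \<in> component x \<Longrightarrow> x \<in> component y"
  by (simp add: component_def) metis

lemma component_trans: "y \<in> component x \<Longrightarrow> z \<in> component y \<Longrightarrow> z \<in> component x"
  unfolding component_def
proof clarsimp
  fix a b c d
  assume "(f ^^ a) x = (f ^^ b) y" "(f ^^ c) y = (f ^^ d) z"
  then have "(f ^^ c) ((f ^^ a) x) = (f ^^ b) ((f ^^ d) z)"
    by (simp add: funpow_swap_apply[of c b])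
  then have "(f ^^ (c + a)) x = (f ^^ (b + d)) z"
    by (simp only: funpow_add_apply)
  then show "\<exists>a b. (f ^^ a) x = (f ^^ b) z" by blast
qed

lemma component_eqI: "x \<in> V \<Longrightarrow> y \<in> component x \<Longrightarrow> component y = component x"
  using component_sym component_trans by blast

lemma component_subset: "component x \<subseteq> V"
  by (auto simp: component_def)

lemma funpow_in_component:
  assumes "x \<in> V"
  shows "(f ^^ m) x \<in> component x"
proof -
  have "(f ^^ m) x = (f ^^ 0) ((f ^^ m) x)" by simp
  then show ?thesis using funpow_in_V[OF assms] unfolding component_def by blast
qed

lemma component_closed: "x \<in> V \<Longrightarrow> y \<in> component x \<Longrightarrow> f y \<in> component x"
  using component_trans[of y x "f y"] funpow_in_component[of y 1] component_subset by auto

lemma component_closed_iff: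
  assumes "x \<in> V" "y \<in> V"
  shows "f y \<in> component x \<longleftrightarrow> y \<in> component x"
proof
  assume "f y \<in> component x"
  moreover have "y \<in> component (f y)"
    using component_sym[OF assms(2), of "f y"] funpow_in_component[OF assms(2), of 1] by simp
  ultimately show "y \<in> component x" by (rule component_trans)
qed (rule component_closed[OF assms(1)])

lemma funpow_in_component_iff:
  assumes "x \<in> V" "y \<in> V"
  shows "(f ^^ m) y \<in> component x \<longleftrightarrow> y \<in> component x"
  by (induction m) (use assms component_closed_iff funpow_in_V in auto)

lemma periodic_in_component:
  assumes "periodic u"
  shows "{y\<in>component u. periodic y} = forward_orbit u"
proof
  show "forward_orbit u \<subseteq> {y\<in>component u. periodic y}"
    using assms funpow_in_component periodic_funpow periodic_in_V by (auto simp: forward_orbit_def)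
  show "{y\<in>component u. periodic y} \<subseteq> forward_orbit u"
  proof clarify
    fix y assume "y \<in> component u" "periodic y"
    then obtain a b where "(f ^^ a) u = (f ^^ b) y" by (auto simp: component_def)
    moreover obtain m where "(f ^^ m) ((f ^^ b) y) = y" using funpow_return[OF \<open>periodic y\<close>] .
    ultimately have "y = (f ^^ (m + a)) u" by (simp add: funpow_add_apply)
    then show "y \<in> forward_orbit u" by (auto simp: forward_orbit_eq[OF assms])
  qed
qed

text \<open>A vertex belongs to the component exactly if \<open>f ^^ h\<close> sends it into the cycle, so the component
  is a disjoint union of fibres of \<open>f ^^ h\<close>, one for each cycle vertex.\<close>

lemma card_component:
  assumes "periodic u"
    and height: "\<And>x. x \<in> V \<Longrightarrow> periodic ((f ^^ h) x)"
    and fibre: "\<And>z. periodic z \<Longrightarrow> card {x\<in>V. (f ^^ h) x = z} = w"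
  shows "card (component u) = period u * w"
proof -
  have u: "u \<in> V" using assms(1) periodic_in_V by blast
  have mem: "x \<in> component u \<longleftrightarrow> x \<in> V \<and> (f ^^ h) x \<in> forward_orbit u" for x
    using funpow_in_component_iff[OF u, of x h] height[of x] component_subset[of u]
    by (auto simp flip: periodic_in_component[OF assms(1)])
  have "component u = (\<Union>z\<in>forward_orbit u. {x\<in>V. (f ^^ h) x = z})"
    by (auto simp: mem)
  also have "card \<dots> = (\<Sum>z\<in>forward_orbit u. card {x\<in>V. (f ^^ h) x = z})"
    by (rule card_UN_disjoint) (auto simp: finite_V forward_orbit_def)
  also have "\<dots> = (\<Sum>z\<in>forward_orbit u. w)"
    using assms(1) by (intro sum.cong) (auto simp: fibre periodic_funpow forward_orbit_def)
  finally show ?thesis by (simp add: card_forward_orbit[OF assms(1)])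
qed

lemma char_poly_on_component:
  assumes "periodic u" "card (component u) = period u * w"
  shows "char_poly_on f (component u) =
    (Polynomial.monom 1 (period u * w - period u) * (Polynomial.monom 1 (period u) - 1) :: 'f::idom poly)"
proof -
  have "f ` component u \<subseteq> component u"
    using component_closed[OF periodic_in_V[OF assms(1)]] by blast
  note char_poly_on_periodic_part[OF component_subset this, where ?'f = 'f]
  then show ?thesis
    unfolding periodic_in_component[OF assms(1)] card_forward_orbit[OF assms(1)]
      char_poly_on_forward_orbit[OF assms(1)] assms(2) .
qed

lemma component_disjoint: "disjoint (component ` V)"
  unfolding disjoint_def
proof (intro ballI impI)
  fix A B assume "A \<in> component ` V" "B \<in> component ` V" and ne: "A \<noteq> B"
  then obtain x y where xy: "x \<in> V" "y \<in> V" "A = component x" "B = component y" by blast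
  have "z \<notin> B" if "z \<in> A" for z
    using that ne component_eqI[OF xy(1), of z] component_eqI[OF xy(2), of z] xy(3,4) by metis
  then show "A \<inter> B = {}" by blast
qed

lemma char_poly_on_components:
  "char_poly_on f V = (\<Prod>C\<in>component ` V. char_poly_on f C :: 'f::idom poly)"
proof -
  have "\<Union>(component ` V) = V" using component_refl component_subset by blast
  moreover have "char_poly_on f (\<Union>(component ` V)) = (\<Prod>C\<in>component ` V. char_poly_on f C :: 'f poly)"
    using finite_V component_subset component_closed
    by (intro char_poly_on_Union component_disjoint) (auto intro: finite_subset)
  ultimately show ?thesis by simp
qed

text \<open>A repetition makes the earlier of the two iterates periodic, so it lies beyond the preperiod
  \<open>h\<close>; there, the two indices differ by less than a period.\<close>

lemma inj_on_funpow_preperiod: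
  assumes x: "x \<in> V" and per: "periodic ((f ^^ h) x)"
    and least: "\<And>h'. periodic ((f ^^ h') x) \<Longrightarrow> h \<le> h'"
  shows "inj_on (\<lambda>i. (f ^^ i) x) {..<h + period ((f ^^ h) x)}"
proof (rule linorder_inj_onI)
  let ?y = "(f ^^ h) x"
  fix a b assume ab: "a < b" "a \<in> {..<h + period ?y}" "b \<in> {..<h + period ?y}"
  show "(f ^^ a) x \<noteq> (f ^^ b) x"
  proof
    assume eq: "(f ^^ a) x = (f ^^ b) x"
    have "h \<le> a" using periodicI_repeat[OF x ab(1) eq] by (rule least)
    then have "(f ^^ (a - h)) ?y = (f ^^ (b - h)) ?y"
      using eq ab(1) by (simp flip: funpow_add_apply)
    then have "a - h = b - h"
      using inj_on_funpow_period[OF per] ab \<open>h \<le> a\<close> by (auto dest!: inj_onD)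
    then show False using ab(1) \<open>h \<le> a\<close> by simp
  qed
qed auto

section \<open>The digraph of a self-map\<close>

definition map_digraph :: "('v, 'v \<times> 'v) pre_digraph" where
  "map_digraph = with_proj \<lparr>pverts = V, parcs = {(a, b). a \<in> V \<and> b \<in> V \<and> f a = b}\<rparr>"

lemma map_digraph_simps [simp]:
  "verts map_digraph = V" "arcs map_digraph = {(a, b). a \<in> V \<and> b \<in> V \<and> f a = b}"
  "tail map_digraph = fst" "head map_digraph = snd"
  by (simp_all add: map_digraph_def)

lemma wf_map_digraph: "wf_digraph map_digraph"
  by unfold_locales auto

sublocale G: wf_digraph map_digraph
  by (rule wf_map_digraph)

text \<open>Since every vertex has a single out-arc, a walk is determined by its start and length.\<close>

lemma awalk_map_digraph_iff:
  "G.awalk u p v \<longleftrightarrow> u \<in> V \<and> v = (f ^^ length p) u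
     \<and> p = map (\<lambda>i. ((f ^^ i) u, (f ^^ Suc i) u)) [0..<length p]"
proof (induction p arbitrary: u)
  case Nil
  then show ?case by (auto simp: G.awalk_Nil_iff)
next
  case (Cons e p)
  let ?walk = "\<lambda>u n. map (\<lambda>i. ((f ^^ i) u, (f ^^ Suc i) u)) [0..<n]"
  have "?walk u (Suc (length p)) = (u, f u) # ?walk (f u) (length p)"
    by (simp only: map_upt_Suc funpow_Suc_right) (simp add: funpow_Suc_right del: funpow.simps(2))
  then have walk: "e # p = ?walk u (length (e # p)) \<longleftrightarrow> e = (u, f u) \<and> p = ?walk (f u) (length p)"
    by (simp only: length_Cons list.inject)
  have "G.awalk u (e # p) v \<longleftrightarrow> u \<in> V \<and> e = (u, f u) \<and> G.awalk (f u) p v"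
    using maps_to by (cases e) (auto simp: G.awalk_Cons_iff)
  also have "\<dots> \<longleftrightarrow> u \<in> V \<and> v = (f ^^ length p) (f u) \<and> e = (u, f u) \<and> p = ?walk (f u) (length p)"
    unfolding Cons.IH using maps_to by blast
  also have "(f ^^ length p) (f u) = (f ^^ length (e # p)) u"
    by (simp add: funpow_Suc_right del: funpow.simps(2))
  finally show ?case unfolding walk .
qed

lemma cycle_map_digraph_iff:
  "G.cycle p \<longleftrightarrow> (\<exists>u. periodic u \<and> p = map (\<lambda>i. ((f ^^ i) u, (f ^^ Suc i) u)) [0..<period u])"
proof
  assume "G.cycle p"
  then obtain u where u: "G.awalk u p u" "distinct (tl (G.awalk_verts u p))" "p \<noteq> []"
    unfolding G.cycle_def by blast
  have p: "u \<in> V" "(f ^^ length p) u = u"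
    "p = map (\<lambda>i. ((f ^^ i) u, (f ^^ Suc i) u)) [0..<length p]"
    using u(1) by (auto simp: awalk_map_digraph_iff)
  have per: "periodic u" using p u(3) by (auto simp: periodic_def)
  have "G.awalk_verts u p = u # map snd p"
    using u by (subst G.awalk_verts_conv') (auto simp: G.awalk_def G.cas_simp)
  then have "distinct (map snd p)" using u(2) by simp
  then have "distinct (map (\<lambda>i. (f ^^ Suc i) u) [0..<length p])"
    by (subst (asm) p(3)) (simp add: comp_def)
  then have inj: "inj_on (\<lambda>i. (f ^^ Suc i) u) {..<length p}"
    by (simp add: distinct_map atLeast0LessThan)
  have "period u = length p"
  proof (rule antisym)
    show "period u \<le> length p" using p u(3) by (intro period_le) auto
    show "length p \<le> period u"
    proof (rule ccontr)
      assume less: "\<not> length p \<le> period u"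
      have "(f ^^ Suc 0) u = (f ^^ Suc (period u)) u"
        using period_props[OF per] by simp
      then have "0 = period u"
        using inj less by (auto dest!: inj_onD[where x = 0 and y = "period u"])
      then show False using period_props(1)[OF per] by simp
    qed
  qed
  then show "\<exists>u. periodic u \<and> p = map (\<lambda>i. ((f ^^ i) u, (f ^^ Suc i) u)) [0..<period u]"
    using per p(3) by metis
next
  assume "\<exists>u. periodic u \<and> p = map (\<lambda>i. ((f ^^ i) u, (f ^^ Suc i) u)) [0..<period u]"
  then obtain u where per: "periodic u"
    and p: "p = map (\<lambda>i. ((f ^^ i) u, (f ^^ Suc i) u)) [0..<period u]" by blast
  have aw: "G.awalk u p u"
    using period_props[OF per] periodic_in_V[OF per] by (simp add: awalk_map_digraph_iff p)
  have ne: "p \<noteq> []" using period_props(1)[OF per] p by auto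
  have "G.awalk_verts u p = u # map snd p"
    using aw ne by (subst G.awalk_verts_conv') (auto simp: G.awalk_def G.cas_simp)
  moreover have "distinct (map snd p)"
  proof -
    have "inj_on (\<lambda>i. (f ^^ Suc i) u) {..<period u}"
    proof (rule inj_onI)
      fix a b assume ab: "a \<in> {..<period u}" "b \<in> {..<period u}" "(f ^^ Suc a) u = (f ^^ Suc b) u"
      have "(f ^^ (period u - 1)) ((f ^^ Suc i) u) = (f ^^ i) u" for i
      proof -
        have "(f ^^ (period u - 1)) ((f ^^ Suc i) u) = (f ^^ (i + period u)) u"
        proof -
          have "period u - 1 + Suc i = i + period u" using period_props(1)[OF per] by simp
          then show ?thesis by (simp only: flip: funpow_add_apply)
        qed
        then show ?thesis using period_props(2)[OF per] by (simp add: funpow_add_apply)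
      qed
      then have "(f ^^ a) u = (f ^^ b) u" using ab(3) by metis
      then show "a = b" using inj_on_funpow_period[OF per] ab by (auto dest: inj_onD)
    qed
    then show ?thesis by (simp add: p comp_def distinct_map atLeast0LessThan)
  qed
  ultimately show "G.cycle p" using aw ne unfolding G.cycle_def by auto
qed

lemma cycle_vertex_map_digraph: "cycle_vertex map_digraph v \<longleftrightarrow> periodic v"
proof
  assume "cycle_vertex map_digraph v"
  then show "periodic v"
    by (auto simp: cycle_vertex_def cycle_map_digraph_iff periodic_funpow)
next
  assume v: "periodic v"
  let ?p = "map (\<lambda>i. ((f ^^ i) v, (f ^^ Suc i) v)) [0..<period v]"
  have "G.cycle ?p" using v cycle_map_digraph_iff by blast
  moreover have "v \<in> tail map_digraph ` set ?p"
    using period_props(1)[OF v] by (auto simp: image_image intro!: image_eqI[where x = 0])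
  ultimately show "cycle_vertex map_digraph v" unfolding cycle_vertex_def by blast
qed

text \<open>A component of the map contains both ends of an arc as soon as it contains one, so a connected
  subgraph cannot leave it. This gives both the maximality of the induced subgraphs and the fact
  that there are no other weak components.\<close>

lemma connected_subgraph_component:
  assumes "subgraph C map_digraph" "Digraph_Component.connected C" "v \<in> verts C"
  shows "subgraph C (map_digraph \<restriction> component v)"
proof -
  interpret C: wf_digraph C using assms(1) by (auto simp: subgraph_def)
  have v: "v \<in> V" using assms(1,3) by (auto simp: subgraph_def)
  have sub: "arcs C \<subseteq> arcs map_digraph" "tail C = fst" "head C = snd" "verts C \<subseteq> V"
    using assms(1) by (auto simp: subgraph_def compatible_def)
  have adj: "y \<in> component v" if "(x, y) \<in> parcs (mk_symmetric C)" "x \<in> component v" for x y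
    using that sub component_closed_iff[OF v]
    by (auto simp: parcs_mk_symmetric)
  have "u \<in> component v" if "u \<in> verts C" for u
  proof -
    interpret M: pair_wf_digraph "mk_symmetric C" by (rule C.wellformed_mk_symmetric)
    have "v \<rightarrow>\<^sup>*\<^bsub>mk_symmetric C\<^esub> u"
      using assms that by (auto simp: connected_def strongly_connected_def)
    then show ?thesis
    proof (induction rule: M.reachable_induct)
      case base
      show ?case by (rule component_refl[OF v])
    next
      case (step x y)
      then show ?case using adj by auto
    qed
  qed
  then have "verts C \<subseteq> component v" by blast
  then show ?thesis
    using sub assms(1) C.wellformed
    by (intro subgraphI C.wf_digraph G.wellformed_induce_subgraph)
      (auto simp: subgraph_def compatible_def subset_iff)
qed

lemma subgraph_induce_component: "subgraph (map_digraph \<restriction> component v) map_digraph"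
  using component_subset by (intro G.subgraph_induce_subgraphI) simp

text \<open>Every vertex reaches, by forward steps inside its component, a common descendant with any
  other vertex of the component.\<close>

lemma connected_component:
  assumes v: "v \<in> V"
  shows "Digraph_Component.connected (map_digraph \<restriction> component v)"
proof -
  let ?C = "map_digraph \<restriction> component v"
  interpret C: wf_digraph ?C by (rule G.wellformed_induce_subgraph)
  have reach: "y \<rightarrow>\<^sup>*\<^bsub>?C\<^esub> (f ^^ m) y" if "y \<in> component v" for y m
  proof (induction m)
    case 0
    then show ?case using that by simp
  next
    case (Suc m)
    have y: "(f ^^ m) y \<in> component v" "(f ^^ Suc m) y \<in> component v"
      using that component_subset funpow_in_component_iff[OF v] by blast+
    then have "((f ^^ m) y, (f ^^ Suc m) y) \<in> arcs ?C"
      using component_subset by auto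
    from C.in_arcs_imp_in_arcs_ends[OF this]
    have "(f ^^ m) y \<rightarrow>\<^bsub>?C\<^esub> (f ^^ Suc m) y" by simp
    with Suc show ?case by (rule C.reachable_adj_trans)
  qed
  show ?thesis
  proof (rule C.connectedI)
    show "verts ?C \<noteq> {}" using component_refl[OF v] by auto
    fix x y assume "x \<in> verts ?C" "y \<in> verts ?C"
    then have xy: "x \<in> component v" "y \<in> component v" by auto
    then have "x \<in> V" "y \<in> component x"
      using component_subset component_eqI[OF v] by auto
    then obtain a b where ab: "(f ^^ a) x = (f ^^ b) y" by (auto simp: component_def)
    interpret M: pair_wf_digraph "mk_symmetric ?C" by (rule C.wellformed_mk_symmetric)
    have "x \<rightarrow>\<^sup>*\<^bsub>mk_symmetric ?C\<^esub> (f ^^ a) x"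
      by (rule C.reachable_mk_symmetricI[OF reach[OF xy(1)]])
    moreover have "(f ^^ b) y \<rightarrow>\<^sup>*\<^bsub>mk_symmetric ?C\<^esub> y"
      by (rule symmetric_reachable[OF symmetric_mk_symmetric
            C.reachable_mk_symmetricI[OF reach[OF xy(2)]]])
    ultimately show "x \<rightarrow>\<^sup>*\<^bsub>mk_symmetric ?C\<^esub> y"
      unfolding ab by (rule M.reachable_trans)
  qed
qed

lemma weak_components_map_digraph:
  "weak_components map_digraph = (\<lambda>v. map_digraph \<restriction> component v) ` V"
proof
  have sub: "subgraph (map_digraph \<restriction> component v) map_digraph" for v
    by (rule subgraph_induce_component)
  show "weak_components map_digraph \<subseteq> (\<lambda>v. map_digraph \<restriction> component v) ` V"
  proof
    fix C assume "C \<in> weak_components map_digraph"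
    then have C: "pre_digraph.max_subgraph map_digraph Digraph_Component.connected C"
      by (simp add: weak_components_def)
    then have sC: "subgraph C map_digraph" and cC: "Digraph_Component.connected C"
      by (auto simp: pre_digraph.max_subgraph_def)
    then obtain v where v: "v \<in> verts C"
      by (auto simp: connected_def strongly_connected_def)
    then have vV: "v \<in> V" using sC by (auto simp: subgraph_def)
    have "C = map_digraph \<restriction> component v"
      using C connected_subgraph_component[OF sC cC v] connected_component[OF vV] sub[of v]
      unfolding pre_digraph.max_subgraph_def by metis
    then show "C \<in> (\<lambda>v. map_digraph \<restriction> component v) ` V" using vV by blast
  qed
  show "(\<lambda>v. map_digraph \<restriction> component v) ` V \<subseteq> weak_components map_digraph"
  proof clarify
    fix v assume v: "v \<in> V"
    let ?C = "map_digraph \<restriction> component v"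
    have "H = ?C" if H: "subgraph ?C H" "subgraph H map_digraph" "Digraph_Component.connected H" for H
    proof -
      have "v \<in> verts H" using H(1) component_refl[OF v] by (auto simp: subgraph_def)
      then have "subgraph H ?C" by (rule connected_subgraph_component[OF H(2,3)])
      then show ?thesis using H(1)
        by (intro pre_digraph.equality) (auto simp: subgraph_def compatible_def)
    qed
    then show "?C \<in> weak_components map_digraph"
      using sub[of v] connected_component[OF v]
      unfolding weak_components_def pre_digraph.max_subgraph_def by blast
  qed
qed

lemma finite_weak_components: "finite (weak_components map_digraph)"
  by (simp add: weak_components_map_digraph finite_V)

lemma wf_weak_component: "C \<in> weak_components map_digraph \<Longrightarrow> wf_digraph C"
  by (auto simp: weak_components_map_digraph)

lemma cycle_in_component:
  assumes "v \<in> V" "pre_digraph.cycle (map_digraph \<restriction> component v) p"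
  obtains u where "periodic u" "component v = component u" "length p = period u"
proof -
  let ?C = "map_digraph \<restriction> component v"
  have sub: "subgraph ?C map_digraph"
    by (rule subgraph_induce_component)
  then have "G.cycle p" using assms(2) by (rule G.subgraph_cycle)
  then obtain u where u: "periodic u" "p = map (\<lambda>i. ((f ^^ i) u, (f ^^ Suc i) u)) [0..<period u]"
    by (auto simp: cycle_map_digraph_iff)
  have "set p \<subseteq> arcs ?C"
    using assms(2) by (auto simp: pre_digraph.cycle_def pre_digraph.awalk_def)
  moreover have "(u, f u) \<in> set p"
    using u(2) period_props(1)[OF u(1)] by (force intro!: image_eqI[where x = 0])
  ultimately have "u \<in> component v" by auto
  then have "component v = component u" using component_eqI[OF assms(1)] by simp
  then show ?thesis using that u by simp
qed

text \<open>The cycle lengths \<open>r\<close> are left to the caller because they are known only through cycles of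
  isomorphic copies of the components.\<close>

lemma char_poly_on_weak_components:
  assumes height: "\<And>x. x \<in> V \<Longrightarrow> periodic ((f ^^ h) x)"
    and fibre: "\<And>z. periodic z \<Longrightarrow> card {x\<in>V. (f ^^ h) x = z} = w"
    and cyc: "\<And>C. C \<in> weak_components map_digraph \<Longrightarrow> \<exists>p. pre_digraph.cycle C p \<and> length p = r C"
  shows "char_poly_on f V = (\<Prod>C\<in>weak_components map_digraph.
    Polynomial.monom 1 (r C * w - r C) * (Polynomial.monom 1 (r C) - 1) :: 'f::idom poly)"
proof -
  have eq: "char_poly_on f (verts C) =
      (Polynomial.monom 1 (r C * w - r C) * (Polynomial.monom 1 (r C) - 1) :: 'f poly)"
    if C: "C \<in> weak_components map_digraph" for C
  proof -
    obtain v where v: "v \<in> V" "C = map_digraph \<restriction> component v"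
      using C by (auto simp: weak_components_map_digraph)
    obtain p where p: "pre_digraph.cycle C p" "length p = r C" using cyc[OF C] by blast
    obtain u where u: "periodic u" "component v = component u" "length p = period u"
      using cycle_in_component v p(1) by metis
    have "char_poly_on f (component u) =
      (Polynomial.monom 1 (period u * w - period u) * (Polynomial.monom 1 (period u) - 1) :: 'f poly)"
      using u(1) card_component[OF u(1) height fibre] by (rule char_poly_on_component)
    then show ?thesis using u v p(2) by simp
  qed
  have "component ` V = verts ` weak_components map_digraph"
    by (simp add: weak_components_map_digraph image_image)
  moreover have "inj_on verts (weak_components map_digraph)"
    by (auto simp: weak_components_map_digraph inj_on_def)
  ultimately have "char_poly_on f V = (\<Prod>C\<in>weak_components map_digraph. char_poly_on f (verts C) :: 'f poly)"
    unfolding char_poly_on_components by (simp add: prod.reindex)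
  also have "\<dots> = (\<Prod>C\<in>weak_components map_digraph.
    Polynomial.monom 1 (r C * w - r C) * (Polynomial.monom 1 (r C) - 1))"
    by (rule prod.cong) (simp_all add: eq)
  finally show ?thesis .
qed

end

section \<open>Polynomials in the matrix of a self-map\<close>

lemma poly_at_mat_props:
  assumes A: "(A :: 'f::field mat) \<in> carrier_mat n n"
  shows "poly_at_mat p A \<in> carrier_mat n n"
    and "i < n \<Longrightarrow> j < n \<Longrightarrow>
      poly_at_mat p A $$ (i, j) = (\<Sum>m\<le>Polynomial.degree p. Polynomial.coeff p m * (A ^\<^sub>m m) $$ (i, j))"
proof -
  interpret R: ring "ring_mat TYPE('f) n ()" by (rule ring_mat)
  let ?M = "\<lambda>m. Polynomial.coeff p m \<cdot>\<^sub>m (A ^\<^sub>m m)"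
  have M: "?M m \<in> carrier (ring_mat TYPE('f) n ())" for m
    using A by (simp add: ring_mat_def)
  have sum: "finsum (ring_mat TYPE('f) n ()) ?M F \<in> carrier_mat n n \<and>
      (i < n \<longrightarrow> j < n \<longrightarrow> finsum (ring_mat TYPE('f) n ()) ?M F $$ (i, j) = (\<Sum>m\<in>F. ?M m $$ (i, j)))"
    if "finite F" for F i j
    using that
  proof (induction F rule: finite_induct)
    case empty
    then show ?case by (simp add: R.finsum_empty) (simp add: ring_mat_def)
  next
    case (insert a F)
    have "finsum (ring_mat TYPE('f) n ()) ?M (insert a F) = ?M a + finsum (ring_mat TYPE('f) n ()) ?M F"
      using insert.hyps M by (subst R.finsum_insert) (auto simp: ring_mat_simps)
    then show ?case using insert A by auto
  qed
  have dim: "dim_row A = n" using A by auto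
  show "poly_at_mat p A \<in> carrier_mat n n"
    unfolding poly_at_mat_def dim using sum by blast
  assume "i < n" "j < n"
  then show "poly_at_mat p A $$ (i, j) = (\<Sum>m\<le>Polynomial.degree p. Polynomial.coeff p m * (A ^\<^sub>m m) $$ (i, j))"
    unfolding poly_at_mat_def dim using sum[of "{..Polynomial.degree p}" i j] pow_carrier_mat[OF A] A
    by (simp add: index_smult_mat)
qed

lemma transition_mat_pow:
  fixes f :: "'v \<Rightarrow> 'v"
  assumes "distinct vs" "f ` set vs \<subseteq> set vs"
  shows "transition_mat f vs ^\<^sub>m m = (transition_mat (f ^^ m) vs :: 'f::semiring_1 mat)"
proof (induction m)
  case 0
  show ?case
    using assms(1) by (intro eq_matI) (auto simp: transition_mat_def nth_eq_iff_index_eq)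
next
  case (Suc m)
  show ?case
  proof (rule eq_matI)
    fix i j assume "i < dim_row (transition_mat (f ^^ Suc m) vs)" "j < dim_col (transition_mat (f ^^ Suc m) vs)"
    then have ij: "i < length vs" "j < length vs" by auto
    have in_vs: "(f ^^ m) (vs ! i) \<in> set vs"
      using ij assms(2) by (induction m) auto
    have "((transition_mat f vs :: 'f mat) ^\<^sub>m Suc m) $$ (i, j)
        = (\<Sum>l = 0..<length vs. (if (f ^^ m) (vs ! i) = vs ! l then 1 else 0)
            * (if f (vs ! l) = vs ! j then 1 else 0))"
      using ij unfolding pow_mat.simps Suc.IH by (simp add: transition_mat_def scalar_prod_def)
    also have "\<dots> = (if f ((f ^^ m) (vs ! i)) = vs ! j then 1 else 0)"
      by (subst sum_indicator_nth[OF assms(1), where F = "\<lambda>y. if f y = vs ! j then 1 else 0"])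
        (simp add: in_vs)
    also have "\<dots> = transition_mat (f ^^ Suc m) vs $$ (i, j)"
      using ij by (simp add: transition_mat_def)
    finally show "((transition_mat f vs :: 'f mat) ^\<^sub>m Suc m) $$ (i, j) = transition_mat (f ^^ Suc m) vs $$ (i, j)" .
  qed (simp_all add: Suc.IH)
qed

text \<open>A polynomial that annihilates the matrix and has degree less than the number of distinct
  iterates of one vertex vanishes: the row of that vertex lists its coefficients.\<close>

lemma is_min_poly_transition_mat:
  fixes f :: "'v \<Rightarrow> 'v"
  assumes vs: "distinct vs" "f ` set vs \<subseteq> set vs"
    and "l > 0"
    and repeat: "\<And>x. x \<in> set vs \<Longrightarrow> (f ^^ (h + l)) x = (f ^^ h) x"
    and g: "g \<in> set vs" "inj_on (\<lambda>i. (f ^^ i) g) {..<h + l}"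
  shows "is_min_poly (transition_mat f vs :: 'f::field mat)
    (Polynomial.monom 1 h * (Polynomial.monom 1 l - 1))"
proof -
  define n where "n = length vs"
  define A where "A = (transition_mat f vs :: 'f mat)"
  define p :: "'f poly" where "p = Polynomial.monom 1 h * (Polynomial.monom 1 l - 1)"
  have A: "A \<in> carrier_mat n n" by (simp add: A_def n_def)
  have p: "p = Polynomial.monom 1 (h + l) - Polynomial.monom 1 h"
    by (simp add: p_def algebra_simps mult_monom)
  have coeff_p: "Polynomial.coeff p m = (if m = h + l then 1 else 0) - (if m = h then 1 else 0)" for m
    by (simp add: p)
  have deg: "Polynomial.degree p = h + l"
  proof (rule antisym)
    show "Polynomial.degree p \<le> h + l" by (rule degree_le) (simp add: coeff_p)
    show "h + l \<le> Polynomial.degree p" by (rule le_degree) (use \<open>l > 0\<close> in \<open>simp add: coeff_p\<close>)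
  qed
  have in_vs: "(f ^^ m) x \<in> set vs" if "x \<in> set vs" for m x
    using that vs(2) by (induction m) auto
  have entry: "poly_at_mat q A $$ (i, j)
      = (\<Sum>m\<le>Polynomial.degree q. if (f ^^ m) (vs ! i) = vs ! j then Polynomial.coeff q m else 0)"
    if "i < n" "j < n" for q i j
    unfolding poly_at_mat_props(2)[OF A that] unfolding A_def transition_mat_pow[OF vs]
    by (rule sum.cong) (use that in \<open>auto simp: n_def transition_mat_def\<close>)
  have "poly_at_mat p A = 0\<^sub>m n n"
  proof (rule eq_matI)
    fix i j assume "i < dim_row (0\<^sub>m n n)" "j < dim_col (0\<^sub>m n n)"
    then have ij: "i < n" "j < n" by auto
    have "poly_at_mat p A $$ (i, j) = (\<Sum>m\<le>h + l.
        (if m = h + l then if (f ^^ (h + l)) (vs ! i) = vs ! j then 1 else 0 else 0)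
        - (if m = h then if (f ^^ h) (vs ! i) = vs ! j then 1 else 0 else 0))"
      unfolding entry[OF ij] deg by (rule sum.cong) (auto simp: coeff_p)
    also have "\<dots> = (if (f ^^ (h + l)) (vs ! i) = vs ! j then 1 else 0)
        - (if (f ^^ h) (vs ! i) = vs ! j then 1 else 0)"
      by (simp add: sum_subtractf)
    also have "\<dots> = 0" using repeat[of "vs ! i"] ij n_def by simp
    finally show "poly_at_mat p A $$ (i, j) = 0\<^sub>m n n $$ (i, j)" using ij by simp
  qed (use poly_at_mat_props(1)[OF A, of p] in auto)
  moreover have "monic p"
    using \<open>l > 0\<close> by (simp add: deg coeff_p)
  moreover have "Polynomial.degree p \<le> Polynomial.degree q"
    if q: "monic q" "poly_at_mat q A = 0\<^sub>m n n" for q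
  proof (rule ccontr)
    let ?d = "Polynomial.degree q"
    assume "\<not> Polynomial.degree p \<le> ?d"
    then have less: "?d < h + l" by (simp add: deg)
    obtain i where i: "i < n" "vs ! i = g" using g(1) by (metis in_set_conv_nth n_def)
    obtain j where j: "j < n" "vs ! j = (f ^^ ?d) g"
      using in_vs[OF g(1), of ?d] by (metis in_set_conv_nth n_def)
    have "0 = poly_at_mat q A $$ (i, j)" using q i j by simp
    also have "\<dots> = (\<Sum>m\<le>?d. if m = ?d then Polynomial.coeff q m else 0)"
      unfolding entry[OF i(1) j(1)] i(2) j(2)
      using less by (intro sum.cong) (auto simp: inj_on_eq_iff[OF g(2)])
    also have "\<dots> = 1" using q(1) by simp
    finally show False by simp
  qed
  moreover have "dim_row A = n" using A by auto
  ultimately show ?thesis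
    unfolding is_min_poly_def A_def[symmetric] p_def[symmetric] by simp
qed

section \<open>The power map on a finite cyclic group\<close>

locale cyclic_power_map = comm_group H for H (structure) +
  fixes g and k :: nat
  assumes finite_H: "finite (carrier H)"
    and gen: "g \<in> carrier H" and carrier_eq: "carrier H = range (\<lambda>j::nat. g [^] j)"
    and k_pos: "k > 0"
begin

abbreviation F where "F \<equiv> \<lambda>x. x [^] k"

sublocale P: finite_self_map "carrier H" F
  by unfold_locales (auto simp: finite_H)

lemma power_digraph_eq: "power_digraph H k = P.map_digraph"
  by (simp add: power_digraph_def P.map_digraph_def)

lemma funpow_power_map: "x \<in> carrier H \<Longrightarrow> (F ^^ m) x = x [^] (k ^ m)"
  by (induction m) (auto simp: nat_pow_pow mult.commute)

lemma funpow_power_map_pow: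
  assumes "x \<in> carrier H"
  shows "(F ^^ m) (x [^] (j::nat)) = (F ^^ m) x [^] j"
  using assms by (simp add: funpow_power_map nat_pow_pow mult.commute)

lemma periodic_pow: "P.periodic x \<Longrightarrow> P.periodic (x [^] (j::nat))"
  unfolding P.periodic_def using funpow_power_map_pow[of x _ j] by auto

lemma ord_pos: "x \<in> carrier H \<Longrightarrow> ord x > 0"
  using ord_ge_1[OF finite_H] by fastforce

lemma funpow_fixed_iff:
  assumes "x \<in> carrier H"
  shows "(F ^^ m) x = x \<longleftrightarrow> ord x dvd k ^ m - 1"
proof -
  have "x [^] (k ^ m) = x [^] (k ^ m - 1) \<otimes> x"
    using assms k_pos nat_pow_Suc[of x "k ^ m - 1"] by simp
  then have "(F ^^ m) x = x \<longleftrightarrow> x [^] (k ^ m - 1) = \<one>"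
    using assms by (simp add: funpow_power_map)
  then show ?thesis using assms pow_eq_id by simp
qed

text \<open>The iterates that fix an element are determined by its order, hence so is the period.\<close>

lemma period_eq_if_ord_eq:
  assumes "P.periodic x" "z \<in> carrier H" "ord z = ord x"
  shows "P.period z = P.period x"
  using assms P.periodic_in_V by (intro P.period_unique) (auto simp: funpow_fixed_iff)

text \<open>The order of a periodic element divides some \<open>k^m - 1\<close> with \<open>m > 0\<close>, a number coprime to
  \<open>k\<close>.\<close>

lemma coprime_ord_periodic:
  assumes "P.periodic x"
  shows "coprime (ord x) k"
proof -
  obtain m where m: "m > 0" "ord x dvd k ^ m - 1"
    using assms funpow_fixed_iff by (auto simp: P.periodic_def)
  have "coprime (k ^ m - 1) (k ^ m)"
    using k_pos by (intro coprime_diff_one_left_nat) simp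
  then have "coprime (k ^ m - 1) k \<or> m = 0"
    by (rule iffD1[OF coprime_power_right_iff])
  then have "coprime (k ^ m - 1) k" using m(1) by blast
  then show ?thesis by (rule coprime_divisors[OF m(2) dvd_refl])
qed

text \<open>The height of the generator. The vertex defined next is the cycle vertex at which the orbit of
  the generator enters its cycle.\<close>

definition entry_height :: nat where "entry_height = (LEAST h. P.periodic ((F ^^ h) g))"

definition entry_vertex where "entry_vertex = (F ^^ entry_height) g"

lemma entry_vertex_periodic: "P.periodic entry_vertex"
  unfolding entry_vertex_def entry_height_def using P.eventually_periodic[OF gen] by (rule LeastI_ex)

lemma entry_vertex_in: "entry_vertex \<in> carrier H"
  using entry_vertex_periodic P.periodic_in_V by blast

lemma entry_height_le: "P.periodic ((F ^^ h) g) \<Longrightarrow> entry_height \<le> h"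
  unfolding entry_height_def by (rule Least_le)

lemma funpow_entry_height: "(F ^^ entry_height) (g [^] (j::nat)) = entry_vertex [^] j"
  using gen by (simp add: funpow_power_map_pow entry_vertex_def)

text \<open>The generator is the highest vertex: every other element is a power of it, and powers of
  periodic elements are periodic.\<close>

lemma periodic_funpow_entry_height: "x \<in> carrier H \<Longrightarrow> P.periodic ((F ^^ entry_height) x)"
  using carrier_eq funpow_entry_height periodic_pow[OF entry_vertex_periodic] by auto

lemma periodic_eq_image: "{z. P.periodic z} = (F ^^ entry_height) ` carrier H"
proof
  show "(F ^^ entry_height) ` carrier H \<subseteq> {z. P.periodic z}" using periodic_funpow_entry_height by blast
  show "{z. P.periodic z} \<subseteq> (F ^^ entry_height) ` carrier H"
  proof clarify
    fix z assume z: "P.periodic z"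
    obtain m where "(F ^^ m) ((F ^^ entry_height) z) = z" using P.funpow_return[OF z] .
    then have "z = (F ^^ entry_height) ((F ^^ m) z)" by (simp only: P.funpow_swap_apply[of m])
    then show "z \<in> (F ^^ entry_height) ` carrier H"
      using P.funpow_in_V[OF P.periodic_in_V[OF z]] by blast
  qed
qed

lemma card_periodic: "card {z. P.periodic z} = ord entry_vertex"
proof -
  have "{z. P.periodic z} = generate H {entry_vertex}"
    unfolding periodic_eq_image generate_pow_on_finite_carrier[OF finite_H entry_vertex_in]
    by (subst carrier_eq) (auto simp: funpow_entry_height image_image)
  then show ?thesis using generate_pow_card[OF entry_vertex_in] by simp
qed

lemma ord_g: "ord g = Coset.order H"
proof -
  have "generate H {g} = carrier H"
    unfolding generate_pow_on_finite_carrier[OF finite_H gen] by (subst carrier_eq) auto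
  then show ?thesis using generate_pow_card[OF gen] by (simp add: Coset.order_def)
qed

text \<open>Since \<open>g\<close> to the power \<open>k ^ entry_height\<close> is \<open>entry_vertex\<close>, the group order divides
  \<open>k ^ entry_height\<close> times the order of that vertex; divisors coprime to \<open>k\<close> thus divide the second
  factor.\<close>

lemma coprime_part_eq: "coprime_part (Coset.order H) k = ord entry_vertex"
proof -
  have n: "Coset.order H > 0" using finite_H gen by (auto simp: Coset.order_def card_gt_0_iff)
  have "ord entry_vertex dvd Coset.order H" using entry_vertex_in finite_H by (simp add: ord_dvd_group_order)
  moreover have "d dvd ord entry_vertex" if d: "d dvd Coset.order H" "coprime d k" for d
  proof -
    have "g [^] (k ^ entry_height * ord entry_vertex) = \<one>"
      using pow_ord_eq_1[OF entry_vertex_in] unfolding entry_vertex_def funpow_power_map[OF gen] nat_pow_pow[OF gen] .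
    then have "Coset.order H dvd k ^ entry_height * ord entry_vertex" using gen pow_eq_id ord_g by metis
    then have "d dvd k ^ entry_height * ord entry_vertex" using d(1) dvd_trans by blast
    then show ?thesis using d(2) by (simp add: coprime_dvd_mult_right_iff)
  qed
  ultimately show ?thesis
    unfolding coprime_part_def
    using coprime_ord_periodic[OF entry_vertex_periodic] ord_pos[OF entry_vertex_in] n
    by (intro Max_eqI) (auto dest: dvd_imp_le intro: finite_subset[OF _ finite_divisors_nat])
qed

text \<open>The fibres of the endomorphism \<open>F ^^ entry_height\<close> over its image are cosets of its kernel;
  as the image has order \<open>ord entry_vertex\<close>, counting the group by fibres gives their size.\<close>

lemma card_fibre:
  assumes z: "P.periodic z" and w: "Coset.order H = ord entry_vertex * w"
  shows "card {x \<in> carrier H. (F ^^ entry_height) x = z} = w"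
proof -
  define q where "q = card {x \<in> carrier H. (F ^^ entry_height) x = \<one>}"
  have fib: "card {x \<in> carrier H. (F ^^ entry_height) x = z} = q" if "P.periodic z" for z
  proof -
    have "z \<in> (F ^^ entry_height) ` carrier H"
      using that by (simp flip: periodic_eq_image)
    then obtain z0 where z0: "z0 \<in> carrier H" "z = (F ^^ entry_height) z0" by blast
    have "bij_betw (\<lambda>x. z0 \<otimes> x) {x \<in> carrier H. (F ^^ entry_height) x = \<one>} {x \<in> carrier H. (F ^^ entry_height) x = z}"
    proof (rule bij_betw_byWitness[where f' = "\<lambda>x. inv z0 \<otimes> x"])
      show "(\<lambda>x. z0 \<otimes> x) ` {x \<in> carrier H. (F ^^ entry_height) x = \<one>} \<subseteq> {x \<in> carrier H. (F ^^ entry_height) x = z}"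
        using z0 by (auto simp: funpow_power_map nat_pow_distrib)
      show "(\<lambda>x. inv z0 \<otimes> x) ` {x \<in> carrier H. (F ^^ entry_height) x = z} \<subseteq> {x \<in> carrier H. (F ^^ entry_height) x = \<one>}"
        using z0 by (auto simp: funpow_power_map nat_pow_distrib nat_pow_inv)
    qed (use z0 in \<open>auto simp: m_assoc[symmetric]\<close>)
    then show ?thesis unfolding q_def by (simp add: bij_betw_same_card)
  qed
  have "carrier H = (\<Union>z\<in>{z. P.periodic z}. {x \<in> carrier H. (F ^^ entry_height) x = z})"
    using periodic_funpow_entry_height by auto
  then have "Coset.order H = card (\<Union>z\<in>{z. P.periodic z}. {x \<in> carrier H. (F ^^ entry_height) x = z})"
    by (simp add: Coset.order_def)
  also have "\<dots> = (\<Sum>z\<in>{z. P.periodic z}. card {x \<in> carrier H. (F ^^ entry_height) x = z})"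
    by (rule card_UN_disjoint) (auto simp: finite_H periodic_eq_image)
  also have "\<dots> = ord entry_vertex * q"
    by (simp add: fib card_periodic)
  finally have "w = q" using w ord_pos[OF entry_vertex_in] by simp
  then show ?thesis using fib[OF z] by simp
qed

lemma height_eq: "x \<in> carrier H \<Longrightarrow> height H k x = (LEAST h. P.periodic ((F ^^ h) x))"
  by (simp add: height_def power_digraph_eq P.cycle_vertex_map_digraph funpow_power_map)

lemma max_height_eq: "max_height H k = entry_height"
  unfolding max_height_def
proof (rule Max_eqI)
  show "finite (height H k ` carrier H)" using finite_H by simp
  show "h \<le> entry_height" if "h \<in> height H k ` carrier H" for h
    using that periodic_funpow_entry_height by (auto simp: height_eq intro!: Least_le)
  show "entry_height \<in> height H k ` carrier H"
    using gen height_eq[OF gen] by (auto simp: entry_height_def intro!: image_eqI[where x = g])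
qed

text \<open>The description in \<^const>\<open>cycle_length\<close> has a solution because the iterates of
  \<open>entry_vertex\<close> all have its order, and only one because elements of equal order have equal
  period.\<close>

lemma cycle_length_eq: "cycle_length H k (ord entry_vertex) = P.period entry_vertex"
  unfolding cycle_length_def power_digraph_eq
proof (rule the_equality)
  let ?p = "\<lambda>u. map (\<lambda>i. ((F ^^ i) u, (F ^^ Suc i) u)) [0..<P.period u]"
  have ord_iterate: "ord ((F ^^ i) entry_vertex) = ord entry_vertex" for i
  proof -
    have "(F ^^ i) entry_vertex [^] j = \<one> \<longleftrightarrow> entry_vertex [^] j = \<one>" for j :: nat
    proof
      assume "(F ^^ i) entry_vertex [^] j = \<one>"
      then have "(F ^^ i) (entry_vertex [^] j) = \<one>" using funpow_power_map_pow[OF entry_vertex_in] by simp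
      moreover obtain m where "(F ^^ m) ((F ^^ i) (entry_vertex [^] j)) = entry_vertex [^] j"
        using P.funpow_return[OF periodic_pow[OF entry_vertex_periodic]] .
      ultimately show "entry_vertex [^] j = \<one>" by (simp add: funpow_power_map)
    next
      assume "entry_vertex [^] j = \<one>"
      then show "(F ^^ i) entry_vertex [^] j = \<one>"
        using funpow_power_map_pow[OF entry_vertex_in, of i j] by (simp add: funpow_power_map)
    qed
    then show ?thesis
      using entry_vertex_in P.funpow_in_V[OF entry_vertex_in] by (simp add: ord_unique pow_eq_id)
  qed
  show "\<exists>p. pre_digraph.cycle P.map_digraph p
      \<and> (\<forall>e\<in>set p. ord (tail P.map_digraph e) = ord entry_vertex) \<and> length p = P.period entry_vertex"
    by (rule exI[of _ "?p entry_vertex"]) (use entry_vertex_periodic P.cycle_map_digraph_iff ord_iterate in auto)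
  fix l
  assume "\<exists>p. pre_digraph.cycle P.map_digraph p
      \<and> (\<forall>e\<in>set p. ord (tail P.map_digraph e) = ord entry_vertex) \<and> length p = l"
  then obtain u where u: "P.periodic u" "\<forall>e\<in>set (?p u). ord (fst e) = ord entry_vertex" "P.period u = l"
    by (auto simp: P.cycle_map_digraph_iff)
  have "(u, F u) \<in> set (?p u)"
    using P.period_props(1)[OF u(1)] by (force intro!: image_eqI[where x = 0])
  then have "ord u = ord entry_vertex" using u(2) by force
  then show "l = P.period entry_vertex"
    using period_eq_if_ord_eq[OF entry_vertex_periodic] P.periodic_in_V[OF u(1)] u(3) by simp
qed

lemma funpow_repeat:
  assumes "x \<in> carrier H"
  shows "(F ^^ (entry_height + P.period entry_vertex)) x = (F ^^ entry_height) x"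
proof -
  have "(F ^^ (P.period entry_vertex + entry_height)) (g [^] j) = (F ^^ entry_height) (g [^] j)" for j :: nat
    using P.period_props(2)[OF entry_vertex_periodic]
    by (simp only: P.funpow_add_apply funpow_entry_height funpow_power_map_pow[OF entry_vertex_in])
  then show ?thesis using assms carrier_eq by (auto simp: add.commute)
qed

end

section \<open>Components up to isomorphism\<close>

lemma digraph_iso_cycle:
  assumes "wf_digraph G" "digraph_iso G H" "pre_digraph.cycle G p"
  shows "\<exists>q. pre_digraph.cycle H q \<and> length q = length p"
proof -
  interpret G: wf_digraph G by fact
  obtain hom where hom: "G.digraph_isomorphism hom" "H = app_iso hom G"
    using assms(2) by (auto simp: digraph_iso_def)
  obtain u where u: "G.awalk u p u" "distinct (tl (G.awalk_verts u p))" "p \<noteq> []"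
    using assms(3) by (auto simp: G.cycle_def)
  let ?q = "map (iso_arcs hom) p"
  have "pre_digraph.awalk H (iso_verts hom u) ?q (iso_verts hom u)"
    unfolding hom(2) using u(1) hom(1) by (rule G.awalk_app_isoI)
  moreover have "pre_digraph.awalk_verts H (iso_verts hom u) ?q = map (iso_verts hom) (G.awalk_verts u p)"
    unfolding hom(2) using hom(1) u(1) by (rule G.awalk_verts_app_iso_eq)
  moreover have "set (tl (G.awalk_verts u p)) \<subseteq> verts G"
    using u(1) list.set_sel(2)[OF G.awalk_verts_non_Nil] G.awalk_verts_in_verts by blast
  then have "inj_on (iso_verts hom) (set (tl (G.awalk_verts u p)))"
    using hom(1) by (auto simp: G.digraph_isomorphism_def intro: inj_on_subset)
  ultimately have "pre_digraph.cycle H ?q"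
    using u by (auto simp: pre_digraph.cycle_def map_tl[symmetric] distinct_map)
  then show ?thesis by auto
qed

lemma digraph_iso_cycle_rev:
  assumes "wf_digraph G" "digraph_iso G H" "pre_digraph.cycle H p"
  shows "\<exists>q. pre_digraph.cycle G q \<and> length q = length p"
proof (rule digraph_iso_cycle)
  show "wf_digraph H"
    using assms wf_digraph.wf_digraphI_app_iso by (auto simp: digraph_iso_def)
  show "digraph_iso H G" using assms by (simp add: digraph_iso_swap)
qed fact

text \<open>Each component is isomorphic to exactly one model, as the models are pairwise non-isomorphic;
  so \<open>idx\<close> partitions the components into classes of sizes \<open>m i\<close>, and a product over components of a
  quantity that depends only on the model collapses to a product of powers.\<close>

lemma components_consist_of_classify:
  assumes cons: "components_consist_of G s m Gs"
    and fin: "finite (weak_components G)"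
    and wf: "\<And>C. C \<in> weak_components G \<Longrightarrow> wf_digraph C"
  obtains idx where "\<And>C. C \<in> weak_components G \<Longrightarrow> idx C \<in> {1..s} \<and> digraph_iso C (Gs (idx C))"
    and "\<And>\<phi> :: nat \<Rightarrow> 'c::comm_monoid_mult.
      (\<Prod>C\<in>weak_components G. \<phi> (idx C)) = (\<Prod>i=1..s. \<phi> i ^ m i)"
proof -
  let ?W = "weak_components G"
  obtain idx where idx: "\<And>C. C \<in> ?W \<Longrightarrow> idx C \<in> {1..s} \<and> digraph_iso C (Gs (idx C))"
    using cons unfolding components_consist_of_def by metis
  have cls: "{C \<in> ?W. idx C = i} = {C \<in> ?W. digraph_iso C (Gs i)}" if i: "i \<in> {1..s}" for i
  proof -
    have "idx C = i" if "C \<in> ?W" "digraph_iso C (Gs i)" for C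
    proof (rule ccontr)
      assume "idx C \<noteq> i"
      have "digraph_iso (Gs (idx C)) C"
        using idx[OF that(1)] wf[OF that(1)] by (simp add: digraph_iso_swap)
      then have "digraph_iso (Gs (idx C)) (Gs i)" using that(2) by (rule digraph_iso_trans)
      then show False
        using cons idx[OF that(1)] i \<open>idx C \<noteq> i\<close> unfolding components_consist_of_def by blast
    qed
    then show ?thesis using idx by auto
  qed
  have "(\<Prod>C\<in>?W. \<phi> (idx C)) = (\<Prod>i=1..s. \<phi> i ^ m i)" for \<phi> :: "nat \<Rightarrow> 'c"
  proof -
    have "(\<Prod>C\<in>?W. \<phi> (idx C)) = (\<Prod>i\<in>{1..s}. \<Prod>C\<in>{C \<in> ?W. idx C = i}. \<phi> (idx C))"
      by (rule prod.group[symmetric]) (use fin idx in auto)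
    also have "\<dots> = (\<Prod>i\<in>{1..s}. \<phi> i ^ card {C \<in> ?W. idx C = i})"
      by (rule prod.cong) auto
    also have "\<dots> = (\<Prod>i\<in>{1..s}. \<phi> i ^ m i)"
      using cons by (intro prod.cong) (auto simp: cls components_consist_of_def)
    finally show ?thesis .
  qed
  then show ?thesis using idx that by blast
qed

lemma (in finite_self_map) adjacency_matrix_map_digraph:
  assumes "set vs = V"
  shows "adjacency_matrix map_digraph vs = transition_mat f vs"
proof (rule eq_matI)
  fix i j
  assume "i < dim_row (transition_mat f vs)" "j < dim_col (transition_mat f vs)"
  then have ij: "i < length vs" "j < length vs" by auto
  then have "vs ! i \<in> V" "vs ! j \<in> V" using assms nth_mem by blast+
  then have "{e \<in> arcs map_digraph. tail map_digraph e = vs ! i \<and> head map_digraph e = vs ! j}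
      = (if f (vs ! i) = vs ! j then {(vs ! i, vs ! j)} else {})" by auto
  then have "card {e \<in> arcs map_digraph. tail map_digraph e = vs ! i \<and> head map_digraph e = vs ! j}
      = (if f (vs ! i) = vs ! j then 1 else 0)" by simp
  then show "adjacency_matrix map_digraph vs $$ (i, j) = transition_mat f vs $$ (i, j)"
    unfolding adjacency_matrix_def transition_mat_def using ij by simp
qed (simp_all add: adjacency_matrix_def)

lemma finite_cyclic_group_nat_powers:
  assumes "group H" "cyclic_group H" "finite (carrier H)"
  obtains g where "g \<in> carrier H" "carrier H = range (\<lambda>j::nat. g [^]\<^bsub>H\<^esub> j)"
proof -
  interpret group H by fact
  obtain g where g: "g \<in> carrier H" "carrier H = range (\<lambda>j::int. g [^]\<^bsub>H\<^esub> j)"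
    using assms(2) unfolding cyclic_group by blast
  have "carrier H = generate H {g}" by (subst g(2)) (auto simp: generate_pow[OF g(1)])
  also have "\<dots> = range (\<lambda>j::nat. g [^]\<^bsub>H\<^esub> j)"
    unfolding generate_pow_on_finite_carrier[OF assms(3) g(1)] by auto
  finally show ?thesis by (rule that[OF g(1)])
qed

theorem theorem4p2:
  fixes H :: "('a, 'b) monoid_scheme"
    and n k t w s :: nat
    and m r :: "nat \<Rightarrow> nat"
    and Gs :: "nat \<Rightarrow> ('u, 'd) pre_digraph"
    and vs :: "'a list"
    and A :: "'f::field_char_0 mat"
  assumes "group H" and "cyclic_group H" and "Coset.order H = n"
    and "n > 1" and "1 \<le> k" and "k \<le> n"
    and "t = coprime_part n k" and "n = t * w"
    and "components_consist_of (power_digraph H k) s m Gs"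
    and "\<forall>i\<in>{1..s}. \<exists>p. pre_digraph.cycle (Gs i) p \<and> length p = r i"
    and "distinct vs" and "set vs = verts (power_digraph H k)"
    and "A = adjacency_matrix (power_digraph H k) vs"
  shows "char_poly A =
           (\<Prod>i=1..s. (Polynomial.monom 1 (r i * w - r i) * (Polynomial.monom 1 (r i) - 1)) ^ m i)
         \<and> is_min_poly A
           (Polynomial.monom 1 (max_height H k) * (Polynomial.monom 1 (cycle_length H k t) - 1))"
proof -
  have fin: "finite (carrier H)"
    using \<open>Coset.order H = n\<close> \<open>n > 1\<close> by (metis Coset.order_def card.infinite not_one_less_zero)
  interpret comm_group H
    using \<open>group H\<close> \<open>cyclic_group H\<close> by (rule group.cyclic_imp_abelian_group)
  obtain g where g: "g \<in> carrier H" "carrier H = range (\<lambda>j::nat. g [^]\<^bsub>H\<^esub> j)"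
    using finite_cyclic_group_nat_powers[OF \<open>group H\<close> \<open>cyclic_group H\<close> fin] .
  interpret C: cyclic_power_map H g k
    using fin g \<open>1 \<le> k\<close> by unfold_locales auto
  have t: "t = ord C.entry_vertex"
    using \<open>t = coprime_part n k\<close> \<open>Coset.order H = n\<close> C.coprime_part_eq by simp
  have w: "Coset.order H = ord C.entry_vertex * w"
    using \<open>n = t * w\<close> \<open>Coset.order H = n\<close> t by simp
  have vs: "distinct vs" "set vs = carrier H"
    using \<open>distinct vs\<close> \<open>set vs = _\<close> by (simp_all add: C.power_digraph_eq)
  have A: "A = transition_mat C.F vs"
    using \<open>A = _\<close> by (simp only: C.power_digraph_eq C.P.adjacency_matrix_map_digraph[OF vs(2)])
  let ?W = "weak_components C.P.map_digraph"
  obtain idx where idx: "\<And>D. D \<in> ?W \<Longrightarrow> idx D \<in> {1..s} \<and> digraph_iso D (Gs (idx D))"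
    and prod: "\<And>\<phi> :: nat \<Rightarrow> 'f poly. (\<Prod>D\<in>?W. \<phi> (idx D)) = (\<Prod>i=1..s. \<phi> i ^ m i)"
    using components_consist_of_classify[OF \<open>components_consist_of _ s m Gs\<close>[unfolded C.power_digraph_eq]
        C.P.finite_weak_components C.P.wf_weak_component] by blast
  have cyc: "\<exists>p. pre_digraph.cycle D p \<and> length p = r (idx D)" if "D \<in> ?W" for D
    using digraph_iso_cycle_rev[OF C.P.wf_weak_component[OF that]] idx[OF that] assms(10) by metis
  have "char_poly A = char_poly_on C.F (carrier H)"
    by (simp add: A char_poly_on_eq[OF vs])
  also have "\<dots> = (\<Prod>D\<in>?W. Polynomial.monom 1 (r (idx D) * w - r (idx D))
      * (Polynomial.monom 1 (r (idx D)) - 1))"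
    by (rule C.P.char_poly_on_weak_components[OF C.periodic_funpow_entry_height C.card_fibre[OF _ w] cyc])
  also have "\<dots> = (\<Prod>i=1..s. (Polynomial.monom 1 (r i * w - r i) * (Polynomial.monom 1 (r i) - 1)) ^ m i)"
    by (rule prod)
  finally have char: "char_poly A = \<dots>" .
  have "is_min_poly A (Polynomial.monom 1 C.entry_height * (Polynomial.monom 1 (C.P.period C.entry_vertex) - 1))"
    unfolding A
  proof (rule is_min_poly_transition_mat[OF vs(1)])
    show "C.F ` set vs \<subseteq> set vs" using vs(2) by auto
    show "C.P.period C.entry_vertex > 0" using C.P.period_props(1)[OF C.entry_vertex_periodic] .
    show "(C.F ^^ (C.entry_height + C.P.period C.entry_vertex)) x = (C.F ^^ C.entry_height) x" if "x \<in> set vs" for x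
      using that vs(2) C.funpow_repeat by simp
    show "g \<in> set vs" using g(1) vs(2) by simp
    show "inj_on (\<lambda>i. (C.F ^^ i) g) {..<C.entry_height + C.P.period C.entry_vertex}"
      using C.P.inj_on_funpow_preperiod[OF g(1) C.entry_vertex_periodic[unfolded C.entry_vertex_def] C.entry_height_le]
      by (simp add: C.entry_vertex_def)
  qed
  then show ?thesis
    using char by (simp add: C.max_height_eq C.cycle_length_eq t)
qed

end
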